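(* Let $G$ be a graph of girth $6$ such that $m^{\ast}(G)=3$. Then $\mathrm{b}^{\ast}(G)=4$.
   Context: All graphs are finite, nonempty, undirected, without loops or multiple edges. The girth of a graph is the length of its shortest cycle. A proper vertex coloring of $G$ with $k$ colors is a surjective map $c:V(G)\to\{1,\dots,k\}$ with $c(x)\neq c(y)$ for every edge $xy$. In such a coloring, a vertex $v$ is a b-vertex if for every color $j\neq c(v)$ among the $k$ colors, $v$ has a neighbor of color $j$. A vertex $u$ is nice if for every color $j\neq c(u)$, $u$ has a neighbor of color $j$ that is a b-vertex. A $\mathrm{b}^{\ast}$-coloring of $G$ is a proper coloring that has a nice vertex. $\mathrm{b}^{\ast}(G)$ is the maximum number of colors used in a $\mathrm{b}^{\ast}$-coloring of $G$. $m^{\ast}(G)$ is the largest integer $k\ge 0$ such that some vertex of degree at least $k$ in $G$ has at least $k$ neighbors each of degree at least $k$ in $G$. *)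

theory Defs
  imports Main "HOL-Library.Extended_Nat"
begin

text \<open>Graphs are given by a vertex set and a set of edges, each edge being a two-element set
  of vertices.\<close>

definition simple_graph :: "'a set \<Rightarrow> 'a set set \<Rightarrow> bool" where
  "simple_graph V E \<longleftrightarrow> finite V \<and> V \<noteq> {} \<and> (\<forall>e\<in>E. e \<subseteq> V \<and> card e = 2)"

definition neighbors :: "'a set set \<Rightarrow> 'a \<Rightarrow> 'a set" where
  "neighbors E v = {w. {v, w} \<in> E}"

definition degree :: "'a set set \<Rightarrow> 'a \<Rightarrow> nat" where
  "degree E v = card (neighbors E v)"

text \<open>A cycle is the list of its vertices in cyclic order, the first one not being repeated at the
  end, so its length is the length of the list.\<close>

definition is_cycle :: "'a set set \<Rightarrow> 'a list \<Rightarrow> bool" where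
  "is_cycle E p \<longleftrightarrow> 3 \<le> length p \<and> distinct p \<and>
     (\<forall>i<length p. {p ! i, p ! (Suc i mod length p)} \<in> E)"

text \<open>The girth of an acyclic graph is \<open>\<infinity>\<close>.\<close>

definition girth :: "'a set set \<Rightarrow> enat" where
  "girth E = (INF p\<in>{p. is_cycle E p}. enat (length p))"

definition proper_coloring :: "'a set \<Rightarrow> 'a set set \<Rightarrow> nat \<Rightarrow> ('a \<Rightarrow> nat) \<Rightarrow> bool" where
  "proper_coloring V E k c \<longleftrightarrow> c ` V = {1..k} \<and> (\<forall>x y. {x, y} \<in> E \<longrightarrow> c x \<noteq> c y)"

definition b_vertex :: "'a set set \<Rightarrow> nat \<Rightarrow> ('a \<Rightarrow> nat) \<Rightarrow> 'a \<Rightarrow> bool" where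
  "b_vertex E k c v \<longleftrightarrow> (\<forall>j\<in>{1..k} - {c v}. \<exists>w\<in>neighbors E v. c w = j)"

definition nice_vertex :: "'a set set \<Rightarrow> nat \<Rightarrow> ('a \<Rightarrow> nat) \<Rightarrow> 'a \<Rightarrow> bool" where
  "nice_vertex E k c u \<longleftrightarrow>
     (\<forall>j\<in>{1..k} - {c u}. \<exists>w\<in>neighbors E u. c w = j \<and> b_vertex E k c w)"

definition b_star_coloring :: "'a set \<Rightarrow> 'a set set \<Rightarrow> nat \<Rightarrow> ('a \<Rightarrow> nat) \<Rightarrow> bool" where
  "b_star_coloring V E k c \<longleftrightarrow> proper_coloring V E k c \<and> (\<exists>u\<in>V. nice_vertex E k c u)"

text \<open>The sets under \<open>Max\<close> below are finite and nonempty for every \<open>simple_graph\<close>: in both, \<open>k\<close> is at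
  most \<open>card V\<close>; \<open>0\<close> belongs to the set for \<open>m_star\<close>, and the chromatic number to the set for
  \<open>b_star\<close>.\<close>

definition b_star :: "'a set \<Rightarrow> 'a set set \<Rightarrow> nat" where
  "b_star V E = Max {k. \<exists>c. b_star_coloring V E k c}"

definition m_star :: "'a set \<Rightarrow> 'a set set \<Rightarrow> nat" where
  "m_star V E =
     Max {k. \<exists>v\<in>V. k \<le> degree E v \<and> k \<le> card {w \<in> neighbors E v. k \<le> degree E w}}"

end

theory Submission
  imports Defs
begin

text \<open>A nice vertex \<open>u\<close> of a coloring with \<open>k\<close> colors has at least \<open>k - 1\<close> neighbors of degree at
  least \<open>k - 1\<close>, whence \<open>k - 1 \<le> 3\<close>. Conversely, let \<open>u\<close> have neighbors \<open>v\<^sub>2\<close>, \<open>v\<^sub>3\<close>, \<open>v\<^sub>4\<close> of degree at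
  least 3, choose two further neighbors \<open>w\<^sub>i\<^sub>j\<close> (\<open>j \<noteq> i\<close>) of each \<open>v\<^sub>i\<close>, and give \<open>u\<close>, \<open>v\<^sub>i\<close>, \<open>w\<^sub>i\<^sub>j\<close> the
  colors \<open>1\<close>, \<open>i\<close>, \<open>j\<close>. The coloring of the remaining vertices is greedy, and every vertex of degree
  at most 3 can wait until the end. A vertex of degree at least 4 has at most three
  neighbors of degree at least 4, so it is in danger only if it is adjacent to some \<open>w\<^sub>i\<^sub>j\<close>. These
  vertices are colored first, without any choice: with \<open>i\<close>, if \<open>i\<close> is the only branch of the tree
  that the vertex meets, and with 1 otherwise. As there is no closed walk of length 5, adjacent
  vertices of this kind meet disjoint sets of branches; since there are only three branches, two
  vertices meeting at least two of them each are not adjacent.\<close>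

section \<open>Adjacency and closed walks of length at most 5\<close>

lemma neighbors_iff: "w \<in> neighbors E v \<longleftrightarrow> {v, w} \<in> E"
  by (simp add: neighbors_def)

lemma simple_graph_adjD:
  assumes "simple_graph V E" "{x, y} \<in> E"
  shows "x \<in> V" "y \<in> V" "x \<noteq> y"
  using assms by (auto simp: simple_graph_def)

lemma simple_graph_neighbors:
  assumes "simple_graph V E"
  shows "neighbors E v \<subseteq> V" "finite (neighbors E v)"
proof -
  show "neighbors E v \<subseteq> V"
    using simple_graph_adjD(2)[OF assms] by (auto simp: neighbors_iff)
  then show "finite (neighbors E v)"
    using assms by (auto simp: simple_graph_def intro: finite_subset)
qed

lemma length_cycle_ge_girth:
  assumes "enat n \<le> girth E" "is_cycle E p"
  shows "n \<le> length p"
proof -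
  have "girth E \<le> enat (length p)"
    unfolding girth_def using assms(2) by (intro INF_lower) simp
  with assms(1) have "enat n \<le> enat (length p)" by (rule order_trans)
  then show ?thesis by simp
qed

lemma no_cycle3:
  assumes "simple_graph V E" "enat 6 \<le> girth E" "{a, b} \<in> E" "{b, c} \<in> E" "{c, a} \<in> E"
  shows False
proof -
  have "a \<noteq> b" "b \<noteq> c" "c \<noteq> a"
    by (rule simple_graph_adjD(3)[OF assms(1)], fact)+
  then have "is_cycle E [a, b, c]"
    using assms(3-) by (simp add: is_cycle_def All_less_Suc)
  from length_cycle_ge_girth[OF assms(2) this] show False by simp
qed

text \<open>A closed walk of length 4 may degenerate by running back along an edge, hence the
  disjunction. Later uses exclude one alternative to obtain the other.\<close>

lemma no_cycle4:
  assumes "simple_graph V E" "enat 6 \<le> girth E"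
    and "{a, b} \<in> E" "{b, c} \<in> E" "{c, d} \<in> E" "{d, a} \<in> E"
  shows "a = c \<or> b = d"
proof (rule ccontr)
  assume "\<not> (a = c \<or> b = d)"
  moreover have "a \<noteq> b" "b \<noteq> c" "c \<noteq> d" "d \<noteq> a"
    by (rule simple_graph_adjD(3)[OF assms(1)], fact)+
  ultimately have "is_cycle E [a, b, c, d]"
    using assms(3-) by (simp add: is_cycle_def All_less_Suc)
  from length_cycle_ge_girth[OF assms(2) this] show False by simp
qed

text \<open>Identifying two non-consecutive vertices of the walk leaves a triangle, so no
  distinctness needs to be assumed.\<close>

lemma no_closed_walk5:
  assumes "simple_graph V E" "enat 6 \<le> girth E"
    and "{a, b} \<in> E" "{b, c} \<in> E" "{c, d} \<in> E" "{d, e} \<in> E" "{e, a} \<in> E"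
  shows False
proof -
  note c3 = no_cycle3[OF assms(1,2)]
  have "a \<noteq> b" "b \<noteq> c" "c \<noteq> d" "d \<noteq> e" "e \<noteq> a"
    by (rule simple_graph_adjD(3)[OF assms(1)], fact)+
  moreover have "a \<noteq> c" "a \<noteq> d" "b \<noteq> d" "b \<noteq> e" "c \<noteq> e"
    using c3[of a d e] c3[of a b c] c3[of b e a] c3[of b c d] c3[of c d e] assms(3-) by blast+
  ultimately have "is_cycle E [a, b, c, d, e]"
    using assms(3-) by (simp add: is_cycle_def All_less_Suc)
  from length_cycle_ge_girth[OF assms(2) this] show False by simp
qed

section \<open>Greedy extension of partial colorings\<close>

text \<open>The bound counts neighbors in all of \<open>B\<close>, so a color is free in whatever
  order \<open>B - D\<close> is processed. Only neighbors inside \<open>B\<close> count, which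
  allows coloring in two rounds: first the tree and the vertices of high degree, then the
  rest.\<close>

lemma greedy_extension:
  fixes c :: "'a \<Rightarrow> nat"
  assumes "finite B" "simple_graph V E" "D \<subseteq> B"
    and "\<forall>x\<in>D. c x \<in> {1..k}"
    and "\<forall>x\<in>D. \<forall>y\<in>D. {x, y} \<in> E \<longrightarrow> c x \<noteq> c y"
    and "\<forall>x\<in>B - D. card (neighbors E x \<inter> B) < k"
  shows "\<exists>c'. (\<forall>x\<in>D. c' x = c x) \<and> (\<forall>x\<in>B. c' x \<in> {1..k}) \<and>
    (\<forall>x\<in>B. \<forall>y\<in>B. {x, y} \<in> E \<longrightarrow> c' x \<noteq> c' y)"
proof -
  define A where "A = B - D"
  have B: "B = D \<union> A" using assms(3) by (auto simp: A_def)
  have "finite A" "A \<inter> D = {}" "\<And>x. x \<in> A \<Longrightarrow> card (neighbors E x \<inter> (D \<union> A)) < k"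
    using assms(1,6) unfolding B[symmetric] by (auto simp: A_def)
  then have "\<exists>c'. (\<forall>x\<in>D. c' x = c x) \<and> (\<forall>x\<in>D \<union> A. c' x \<in> {1..k}) \<and>
    (\<forall>x\<in>D \<union> A. \<forall>y\<in>D \<union> A. {x, y} \<in> E \<longrightarrow> c' x \<noteq> c' y)"
  proof (induction A rule: finite_induct)
    case empty
    then show ?case using assms(4,5) by (intro exI[of _ c]) auto
  next
    case (insert a A)
    have fin: "finite (neighbors E x)" for x
      by (rule simple_graph_neighbors(2)[OF assms(2)])
    have "card (neighbors E x \<inter> (D \<union> A)) < k" if "x \<in> A" for x
    proof -
      have "card (neighbors E x \<inter> (D \<union> A)) \<le> card (neighbors E x \<inter> (D \<union> insert a A))"
        by (rule card_mono) (use fin in auto)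
      with insert.prems(2)[of x] that show ?thesis by simp
    qed
    with insert obtain c' where c':
      "\<forall>x\<in>D. c' x = c x" "\<forall>x\<in>D \<union> A. c' x \<in> {1..k}"
      "\<forall>x\<in>D \<union> A. \<forall>y\<in>D \<union> A. {x, y} \<in> E \<longrightarrow> c' x \<noteq> c' y"
      by auto
    let ?N = "neighbors E a \<inter> (D \<union> A)"
    have "a \<notin> neighbors E a"
      using simple_graph_adjD(3)[OF assms(2), of a a] by (auto simp: neighbors_iff)
    then have "?N = neighbors E a \<inter> (D \<union> insert a A)" by auto
    then have "card ?N < k" using insert.prems(2)[of a] by simp
    then have "card (c' ` ?N) < card {1..k}"
      using card_image_le[of ?N c'] fin[of a] by simp
    then have "\<not> {1..k} \<subseteq> c' ` ?N"
      using card_mono[of "c' ` ?N" "{1..k}"] fin[of a] by auto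
    then obtain n where n: "n \<in> {1..k}" "n \<notin> c' ` ?N" by blast
    have nE: "c' y \<noteq> n" if "y \<in> D \<union> A" "{a, y} \<in> E" for y
      using n(2) that by (auto simp: neighbors_iff)
    have "a \<notin> D \<union> A" using insert by auto
    show ?case
    proof (intro exI[of _ "c'(a := n)"] conjI ballI impI)
      fix x y assume xy: "x \<in> D \<union> insert a A" "y \<in> D \<union> insert a A" "{x, y} \<in> E"
      then have "x \<noteq> y" using simple_graph_adjD(3)[OF assms(2)] by blast
      then consider "x = a" "y \<in> D \<union> A" "y \<noteq> a" | "y = a" "x \<in> D \<union> A" "x \<noteq> a"
        | "x \<in> D \<union> A" "y \<in> D \<union> A" "x \<noteq> a" "y \<noteq> a" using xy by auto
      then show "(c'(a := n)) x \<noteq> (c'(a := n)) y"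
      proof cases
        case 1
        then show ?thesis using nE[of y] xy(3) by simp
      next
        case 2
        then show ?thesis using nE[of x] xy(3) by (simp add: insert_commute)
      next
        case 3
        then show ?thesis using c'(3) xy(3) by simp
      qed
    qed (use c' n(1) \<open>a \<notin> D \<union> A\<close> in auto)
  qed
  then show ?thesis unfolding B .
qed

section \<open>The number \<open>m_star\<close> and the upper bound\<close>

lemma m_star_set:
  fixes V :: "'a set"
  assumes "simple_graph V E"
  defines "M \<equiv> {k. \<exists>v\<in>V. k \<le> degree E v \<and> k \<le> card {w \<in> neighbors E v. k \<le> degree E w}}"
  shows "finite M" "m_star V E \<in> M"
proof -
  have "finite V" using assms(1) by (simp add: simple_graph_def)
  then have "degree E v \<le> card V" for v
    using simple_graph_neighbors(1)[OF assms(1)] by (simp add: degree_def card_mono)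
  then have "M \<subseteq> {..card V}" unfolding M_def using order_trans by fastforce
  then show fin: "finite M" by (rule finite_subset) simp
  have "0 \<in> M" using assms(1) by (auto simp: M_def simple_graph_def)
  with fin have "Max M \<in> M" using Max_in by blast
  then show "m_star V E \<in> M" by (simp add: m_star_def M_def)
qed

lemma m_star_ge:
  assumes "simple_graph V E" "v \<in> V" "k \<le> card {w \<in> neighbors E v. k \<le> degree E w}"
  shows "k \<le> m_star V E"
proof -
  have "card {w \<in> neighbors E v. k \<le> degree E w} \<le> degree E v"
    unfolding degree_def using simple_graph_neighbors(2)[OF assms(1)] by (auto intro: card_mono)
  then have "k \<le> degree E v" using assms(3) by simp
  then show ?thesis
    unfolding m_star_def using assms(2,3) m_star_set(1)[OF assms(1)]
    by (intro Max_ge) auto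
qed

text \<open>Different colors occur at different neighbors. This serves twice: to bound the degree of
  a b-vertex, and to count the neighbors of high degree around a nice vertex.\<close>

lemma card_le_neighbors:
  assumes "simple_graph V E" "\<forall>j\<in>J. \<exists>w\<in>neighbors E v. c w = j \<and> P w"
  shows "card J \<le> card {w \<in> neighbors E v. P w}"
proof -
  have "J \<subseteq> c ` {w \<in> neighbors E v. P w}" using assms(2) by auto
  then show ?thesis
    by (intro surj_card_le) (use simple_graph_neighbors(2)[OF assms(1)] in auto)
qed

lemma b_star_coloring_le:
  assumes "simple_graph V E" "b_star_coloring V E k c"
  shows "k \<le> m_star V E + 1"
proof -
  obtain u where u: "u \<in> V" "nice_vertex E k c u" and col: "c ` V = {1..k}"
    using assms(2) by (auto simp: b_star_coloring_def proper_coloring_def)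
  have card: "card ({1..k} - {c v}) = k - 1" if "v \<in> V" for v
  proof -
    have "c v \<in> {1..k}" using that col by blast
    then show ?thesis by simp
  qed
  have "k - 1 \<le> degree E v" if "v \<in> V" "b_vertex E k c v" for v
    using card_le_neighbors[OF assms(1), of "{1..k} - {c v}" v c "\<lambda>_. True"] that card
    by (simp add: b_vertex_def degree_def)
  then have "\<forall>j\<in>{1..k} - {c u}. \<exists>w\<in>neighbors E u. c w = j \<and> k - 1 \<le> degree E w"
    using u(2) simple_graph_neighbors(1)[OF assms(1), of u]
    unfolding nice_vertex_def by blast
  from card_le_neighbors[OF assms(1) this] card[OF u(1)]
  have "k - 1 \<le> m_star V E" using m_star_ge[OF assms(1) u(1)] by simp
  then show ?thesis by simp
qed

section \<open>Construction of a coloring with four colors\<close>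

lemma b_star_coloring_4_exists:
  fixes V :: "'a set"
  assumes graph: "simple_graph V E" and girth: "enat 6 \<le> girth E"
    and high: "\<And>x. x \<in> V \<Longrightarrow> card {y \<in> neighbors E x. 4 \<le> degree E y} \<le> 3"
    and "3 \<le> card {y \<in> neighbors E u. 3 \<le> degree E y}"
  shows "\<exists>c. b_star_coloring V E 4 c"
proof -
  \<comment> \<open>\<open>K\<close> plays two roles: it indexes the three branches at
    \<open>u\<close>, and it is the set of colors other than 1.\<close>
  define K :: "nat set" where "K = {2, 3, 4}"
  have fin: "finite (neighbors E x)" for x
    by (rule simple_graph_neighbors(2)[OF graph])
  have finV: "finite V" using graph by (simp add: simple_graph_def)
  have finK: "finite K" and cardK: "card K = 3" by (simp_all add: K_def)
  note adjD = simple_graph_adjD[OF graph]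
  have adj_sym: "{y, x} \<in> E" if "{x, y} \<in> E" for x y
    using that by (simp add: insert_commute)
  note c3 = no_cycle3[OF graph girth]
    and c4 = no_cycle4[OF graph girth]
    and c5 = no_closed_walk5[OF graph girth]
  obtain v where v_sub: "v ` K \<subseteq> {y \<in> neighbors E u. 3 \<le> degree E y}" and v_inj: "inj_on v K"
    using card_le_inj[OF finK, of "{y \<in> neighbors E u. 3 \<le> degree E y}"] assms(4) fin cardK by auto
  have uv: "{u, v i} \<in> E" and v_deg: "3 \<le> degree E (v i)" if "i \<in> K" for i
    using v_sub that by (auto simp: neighbors_iff)
  have "\<exists>f. f ` (K - {i}) \<subseteq> neighbors E (v i) - {u} \<and> inj_on f (K - {i})" if "i \<in> K" for i
  proof (rule card_le_inj)
    have "card (K - {i}) = 2" using that finK cardK by simp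
    moreover have "card (neighbors E (v i)) - 1 \<le> card (neighbors E (v i) - {u})"
      using card_Diff1_le by (simp add: card_Diff_singleton_if)
    ultimately show "card (K - {i}) \<le> card (neighbors E (v i) - {u})"
      using v_deg[OF that] by (simp add: degree_def)
  qed (use fin finK in auto)
  then obtain w where w: "\<And>i. i \<in> K \<Longrightarrow> w i ` (K - {i}) \<subseteq> neighbors E (v i) - {u}"
    "\<And>i. i \<in> K \<Longrightarrow> inj_on (w i) (K - {i})"
    by metis
  have vw: "{v i, w i j} \<in> E" and w_ne_u: "w i j \<noteq> u" if "i \<in> K" "j \<in> K - {i}" for i j
    using w(1)[OF that(1)] that(2) by (auto simp: neighbors_iff)
  define W where "W i = w i ` (K - {i})" for i
  define T where "T = insert u (v ` K \<union> (\<Union>i\<in>K. W i))"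
  define High where "High = {x \<in> V. 4 \<le> degree E x}"
  define S where "S x = {i \<in> K. \<exists>y\<in>W i. {x, y} \<in> E}" for x
  define X where "X = {x \<in> High - T. S x \<noteq> {}}"
  have W: "{v i, y} \<in> E" "y \<noteq> u" if "i \<in> K" "y \<in> W i" for i y
    using that vw w_ne_u by (auto simp: W_def)
  \<comment> \<open>Otherwise \<open>x\<close>, \<open>v i\<close>, \<open>u\<close>,
    \<open>v i'\<close> would form a 4-cycle.\<close>
  have v_eq: "i = i'" if "{x, v i} \<in> E" "{x, v i'} \<in> E" "x \<noteq> u" "i \<in> K" "i' \<in> K" for x i i'
    using c4[of x "v i" u "v i'"] that uv adj_sym v_inj by (meson inj_onD)
  \<comment> \<open>This makes color 1, given to \<open>u\<close>, harmless for vertices in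
    \<open>X\<close>.\<close>
  have X_not_u: "\<not> {u, x} \<in> E" if x: "x \<in> X" for x
  proof
    assume ux: "{u, x} \<in> E"
    obtain i y where "i \<in> K" "y \<in> W i" "{x, y} \<in> E" using x by (auto simp: X_def S_def)
    moreover have "x \<noteq> v i" using x \<open>i \<in> K\<close> by (auto simp: X_def T_def)
    ultimately show False using c4[of u x y "v i"] ux W uv adj_sym by blast
  qed
  \<comment> \<open>A common branch \<open>i\<close> gives a closed walk of length 5: from
    \<open>x\<close> to \<open>y\<close>, through \<open>W i\<close> to \<open>v i\<close>, and back
    through \<open>W i\<close> to \<open>x\<close>.\<close>
  have S_disj: "S x \<inter> S y = {}" if "{x, y} \<in> E" for x y
    using c5[of x y] that W adj_sym unfolding S_def by blast

  \<comment> \<open>A relation rather than a function: properness can be shown for every choice of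
    related colors, before the roles in the tree are known to exclude each other.\<close>
  define R where "R x n \<longleftrightarrow> x = u \<and> n = 1 \<or> (n \<in> K \<and> x = v n) \<or>
    (\<exists>i\<in>K. n \<in> K - {i} \<and> x = w i n) \<or>
    (x \<in> X \<and> (S x = {n} \<or> n = 1 \<and> (\<exists>i\<in>S x. \<exists>j\<in>S x. i \<noteq> j)))" for x n
  define c0 where "c0 x = (SOME n. R x n)" for x
  have S_K: "S x \<subseteq> K" for x by (auto simp: S_def)
  have K1: "1 \<notin> K" by (simp add: K_def)
  have R_cases: False if E: "{x, y} \<in> E" and R: "R x n" "R y n" for x y n
  proof -
    have uu: "{u, u} \<notin> E" and vv: "{v n, v n} \<notin> E" using adjD(3) by blast+
    have v_w: "{v n, y} \<notin> E" if "n \<in> K" "i \<in> K" "n \<noteq> i" "y \<in> W i" for i y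
      using c4[of "v n" y "v i" u] that W uv adj_sym v_inj by (meson inj_onD)
    have w_w: "{y, y'} \<notin> E" if "i \<in> K" "i' \<in> K" "y \<in> W i" "y' \<in> W i'" for i i' y y'
      using c5[of y "v i" u "v i'" y'] that W uv adj_sym by blast
    have v_X: "{v n, z} \<notin> E" if "S z = {n}" for z
    proof -
      from that obtain y where "n \<in> K" "y \<in> W n" "{z, y} \<in> E" unfolding S_def by blast
      then show ?thesis using c3[of "v n" z y] W adj_sym by blast
    qed
    have w_X: "{w i n, z} \<notin> E" if "i \<in> K" "n \<in> K - {i}" "S z = {n} \<or> n = 1" for i z
    proof
      assume "{w i n, z} \<in> E"
      then have "i \<in> S z" using that adj_sym by (auto simp: S_def W_def)
      then show False using that K1 by auto
    qed
    \<comment> \<open>For \<open>n = 1\<close>, both vertices meet at least two branches, so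
      disjointness would require four elements of \<open>K\<close>. For other \<open>n\<close>, both
      sets equal \<open>{n}\<close>.\<close>
    have X_X: False if "{z, z'} \<in> E"
      and two: "S z = {n} \<or> n = 1 \<and> (\<exists>i\<in>S z. \<exists>j\<in>S z. i \<noteq> j)"
      "S z' = {n} \<or> n = 1 \<and> (\<exists>i\<in>S z'. \<exists>j\<in>S z'. i \<noteq> j)" for z z'
    proof (cases "n = 1")
      case True
      then have "S z \<noteq> {n}" "S z' \<noteq> {n}" using S_K K1 by blast+
      then obtain i j i' j' where ij: "i \<in> S z" "j \<in> S z" "i \<noteq> j" "i' \<in> S z'" "j' \<in> S z'" "i' \<noteq> j'"
        using two by blast
      then have "{i, j, i', j'} \<subseteq> K" using S_K by blast
      from card_mono[OF finK this] cardK have "card {i, j, i', j'} \<le> 3" by simp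
      moreover have "{i, j} \<inter> {i', j'} = {}" using S_disj[OF that(1)] ij by blast
      ultimately show False using ij by (auto simp: card_insert_if)
    next
      case False
      then show False using that S_disj[OF that(1)] by simp
    qed
    have W_w: "w i n \<in> W i" if "n \<in> K - {i}" for i using that by (auto simp: W_def)
    consider (u) "x = u" "n = 1" | (v) "n \<in> K" "x = v n"
      | (w) i where "i \<in> K" "n \<in> K - {i}" "x = w i n"
      | (X) "x \<in> X" "S x = {n} \<or> n = 1 \<and> (\<exists>i\<in>S x. \<exists>j\<in>S x. i \<noteq> j)"
      using R(1) unfolding R_def by blast
    note x_cases = this
    consider (u) "y = u" "n = 1" | (v) "n \<in> K" "y = v n"
      | (w) i where "i \<in> K" "n \<in> K - {i}" "y = w i n"
      | (X) "y \<in> X" "S y = {n} \<or> n = 1 \<and> (\<exists>i\<in>S y. \<exists>j\<in>S y. i \<noteq> j)"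
      using R(2) unfolding R_def by blast
    note y_cases = this
    note E' = adj_sym[OF E]
    show False
    proof (cases rule: x_cases)
      case u
      then show False using E uu X_not_u K1 by (cases rule: y_cases) auto
    next
      case x: v
      then have "n \<noteq> 1" using K1 by blast
      then show False
        using E x vv v_w[OF _ _ _ W_w] v_X by (cases rule: y_cases) auto
    next
      case x: (w i)
      then have "n \<noteq> 1" using K1 by blast
      show False
      proof (cases rule: y_cases)
        case v
        then show False using E' x v_w[OF _ _ _ W_w[OF x(2)]] by blast
      next
        case (w j)
        then show False using E x w_w[OF _ _ W_w[OF x(2)] W_w[OF w(2)]] by blast
      next
        case X
        then show False using E x w_X[OF x(1,2)] by blast
      qed (use \<open>n \<noteq> 1\<close> in simp)
    next
      case x: X
      show False
      proof (cases rule: y_cases)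
        case u
        then show False using E' x X_not_u by blast
      next
        case v
        then show False using E' x v_X K1 by blast
      next
        case (w j)
        then show False using E' x w_X[OF w(1,2)] by blast
      next
        case X
        then show False using X_X[OF E x(2)] by blast
      qed
    qed
  qed
  have R_ex: "\<exists>n. R x n" if "x \<in> T \<union> X" for x
  proof (cases "x \<in> X")
    case True
    then obtain i where "i \<in> S x" by (auto simp: X_def)
    then have "S x = {i} \<or> (\<exists>j\<in>S x. i \<noteq> j)" by auto
    then show ?thesis using True \<open>i \<in> S x\<close> unfolding R_def by blast
  next
    case False
    then show ?thesis using that unfolding R_def T_def W_def by blast
  qed
  have R_c0: "R x (c0 x)" if "x \<in> T \<union> X" for x
    unfolding c0_def using R_ex[OF that] by (rule someI_ex)
  have R_range: "n \<in> {1..4}" if "R x n" for x n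
  proof -
    have "n = 1 \<or> n \<in> K" using that S_K[of x] unfolding R_def by blast
    then show ?thesis by (auto simp: K_def)
  qed
  \<comment> \<open>Properness does not determine which color \<open>SOME\<close> picks. On the tree
    the color must be the prescribed one, so that each \<open>v i\<close> is a b-vertex and
    \<open>u\<close> is nice.\<close>
  have R_uniq: "m = n" if "x \<in> T" "R x m" "R x n" for x m n
  proof -
    have w_ne_v: "w i j \<noteq> v i'" if "i \<in> K" "j \<in> K - {i}" "i' \<in> K" for i j i'
      using c3[of u "v i" "w i j"] vw[OF that(1,2)] uv[OF that(1)] uv[OF that(3)] adj_sym by metis
    have w_eq: "j = j'" if "w i j = w i' j'" "i \<in> K" "j \<in> K - {i}" "i' \<in> K" "j' \<in> K - {i'}" for i j i' j'
    proof -
      have "i = i'"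
        using v_eq[of "w i j" i i'] vw[OF that(2,3)] vw[OF that(4,5)] w_ne_u that adj_sym by simp
      then show ?thesis using w(2)[OF that(2)] that by (auto dest: inj_onD)
    qed
    have u_v: "u \<noteq> v i" if "i \<in> K" for i using adjD(3)[OF uv[OF that]] .
    have "x \<notin> X" using that(1) by (simp add: X_def)
    then show ?thesis
      using that(2,3) w_ne_v w_eq u_v w_ne_u inj_onD[OF v_inj]
      unfolding R_def by metis
  qed
  have c0_eq: "c0 x = n" if "x \<in> T" "R x n" for x n
    using R_uniq[OF that(1) R_c0 that(2)] that(1) by simp

  have T_V: "T \<subseteq> V"
  proof -
    have "u \<in> V" using uv[of 2] adjD(1) by (auto simp: K_def)
    then show ?thesis unfolding T_def using uv W(1) adjD(2) by blast
  qed
  \<comment> \<open>Both \<open>u\<close> and every \<open>v i\<close> have three neighbors inside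
    the tree, so a neighbor outside it is a fourth.\<close>
  have T_high: "4 \<le> degree E t" if t: "t \<in> T" "\<not> t \<in> (\<Union>i\<in>K. W i)" and x: "x \<notin> T" "{x, t} \<in> E" for t x
  proof (cases "t = u")
    case True
    have "insert x (v ` K) \<subseteq> neighbors E t"
      using True x(2) uv adj_sym by (auto simp: neighbors_iff)
    from card_mono[OF fin this] have "card (insert x (v ` K)) \<le> degree E t"
      by (simp add: degree_def)
    moreover have "x \<notin> v ` K" using x(1) by (auto simp: T_def)
    ultimately show ?thesis using card_image[OF v_inj] cardK finK by simp
  next
    case False
    then obtain i where i: "i \<in> K" "t = v i" using t by (auto simp: T_def)
    have "insert x (insert u (W i)) \<subseteq> neighbors E t"
      using i x(2) uv W(1) adj_sym by (auto simp: neighbors_iff)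
    from card_mono[OF fin this] have "card (insert x (insert u (W i))) \<le> degree E t"
      by (simp add: degree_def)
    moreover have "x \<noteq> u" "x \<notin> W i" "u \<notin> W i" using x(1) i(1) W(2) by (auto simp: T_def)
    moreover have "card (W i) = 2" "finite (W i)"
      using card_image[OF w(2)[OF i(1)]] i(1) cardK finK by (simp_all add: W_def)
    ultimately show ?thesis by simp
  qed
  define B where "B = T \<union> X \<union> High"
  \<comment> \<open>Such an \<open>x\<close> is not in \<open>X\<close> and hence has no neighbor in
    any \<open>W i\<close>. All its neighbors in \<open>B\<close> therefore have degree at least 4,
    and \<open>high\<close> allows at most three of these.\<close>
  have high_nb: "\<forall>x\<in>B - (T \<union> X). card (neighbors E x \<inter> B) < 4"
  proof
    fix x assume x: "x \<in> B - (T \<union> X)"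
    have "4 \<le> degree E y" if y: "{x, y} \<in> E" "y \<in> B" for y
    proof (cases "y \<in> T")
      case True
      have "y \<notin> (\<Union>i\<in>K. W i)" using x y(1) by (auto simp: B_def X_def S_def)
      then show ?thesis using T_high[OF True _ _ y(1)] x by blast
    qed (use y(2) in \<open>auto simp: B_def X_def High_def\<close>)
    then have "neighbors E x \<inter> B \<subseteq> {y \<in> neighbors E x. 4 \<le> degree E y}"
      by (auto simp: neighbors_iff)
    then have "card (neighbors E x \<inter> B) \<le> card {y \<in> neighbors E x. 4 \<le> degree E y}"
      by (rule card_mono[rotated]) (use fin in auto)
    with high[of x] x show "card (neighbors E x \<inter> B) < 4" by (auto simp: B_def High_def)
  qed
  have c0_range: "\<forall>x\<in>T \<union> X. c0 x \<in> {1..4}"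
    using R_range[OF R_c0] by blast
  have c0_proper: "\<forall>x\<in>T \<union> X. \<forall>y\<in>T \<union> X. {x, y} \<in> E \<longrightarrow> c0 x \<noteq> c0 y"
    using R_cases R_c0 by metis
  have B_V: "B \<subseteq> V" using T_V by (auto simp: B_def X_def High_def)
  have TX_B: "T \<union> X \<subseteq> B" by (simp add: B_def)
  obtain c1 where c1: "\<forall>x\<in>T \<union> X. c1 x = c0 x" "\<forall>x\<in>B. c1 x \<in> {1..4}"
    "\<forall>x\<in>B. \<forall>y\<in>B. {x, y} \<in> E \<longrightarrow> c1 x \<noteq> c1 y"
    using greedy_extension[OF finite_subset[OF B_V finV] graph TX_B c0_range c0_proper high_nb]
    by (elim exE conjE)
  \<comment> \<open>In the second round every remaining vertex has degree at most 3, so all of its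
    neighbors may be counted.\<close>
  have low_nb: "\<forall>x\<in>V - B. card (neighbors E x \<inter> V) < 4"
  proof
    fix x assume "x \<in> V - B"
    then have "degree E x < 4" by (auto simp: B_def High_def)
    moreover have "neighbors E x \<inter> V = neighbors E x"
      using simple_graph_neighbors(1)[OF graph] by auto
    ultimately show "card (neighbors E x \<inter> V) < 4" by (simp add: degree_def)
  qed
  obtain c where c: "\<forall>x\<in>B. c x = c1 x" "\<forall>x\<in>V. c x \<in> {1..4}"
    "\<forall>x\<in>V. \<forall>y\<in>V. {x, y} \<in> E \<longrightarrow> c x \<noteq> c y"
    using greedy_extension[OF finV graph B_V c1(2,3) low_nb]
    by (elim exE conjE)
  have c_T: "c x = n" if "x \<in> T" "R x n" for x n
    using c(1) c1(1) c0_eq that by (simp add: B_def)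
  have cu: "c u = 1" by (rule c_T) (simp_all add: T_def R_def)
  have cv: "c (v i) = i" if "i \<in> K" for i by (rule c_T) (use that in \<open>auto simp: T_def R_def\<close>)
  have cw: "c (w i j) = j" if "i \<in> K" "j \<in> K - {i}" for i j
    by (rule c_T) (use that in \<open>auto simp: T_def W_def R_def\<close>)
  have set4: "{1..4} = insert 1 K" by (auto simp: K_def)
  have "b_vertex E 4 c (v i)" if i: "i \<in> K" for i
    unfolding b_vertex_def cv[OF i] set4
  proof
    fix j assume j: "j \<in> insert 1 K - {i}"
    show "\<exists>y\<in>neighbors E (v i). c y = j"
    proof (cases "j = 1")
      case True
      then show ?thesis using cu adj_sym[OF uv[OF i]] by (auto simp: neighbors_iff)
    next
      case False
      then show ?thesis using cw[OF i, of j] vw[OF i, of j] j by (auto simp: neighbors_iff)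
    qed
  qed
  then have "nice_vertex E 4 c u"
    unfolding nice_vertex_def cu set4 using cv uv K1 by (fastforce simp: neighbors_iff)
  moreover have "u \<in> V" using T_V by (simp add: T_def)
  moreover have "c ` V = {1..4}"
  proof
    show "c ` V \<subseteq> {1..4}" using c(2) by auto
    have "{1..4} \<subseteq> c ` T" unfolding set4 using cu cv by (force simp: T_def)
    then show "{1..4} \<subseteq> c ` V" using T_V by auto
  qed
  moreover have "c x \<noteq> c y" if "{x, y} \<in> E" for x y
    using c(3) that adjD(1,2)[OF that] by blast
  ultimately show ?thesis unfolding b_star_coloring_def proper_coloring_def by blast
qed

theorem proposition2:
  fixes V :: "'a set" and E :: "'a set set"
  assumes "simple_graph V E"
    and "girth E = 6"
    and "m_star V E = 3"
  shows "b_star V E = 4"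
proof -
  obtain u where u: "3 \<le> card {w \<in> neighbors E u. 3 \<le> degree E w}"
    using m_star_set(2)[OF assms(1)] assms(3) by auto
  \<comment> \<open>Four such neighbors would force \<open>m_star V E\<close> to be at least
    4.\<close>
  have "card {y \<in> neighbors E x. 4 \<le> degree E y} \<le> 3" if "x \<in> V" for x
    using m_star_ge[OF assms(1) that, of 4] assms(3) by linarith
  then obtain c where "b_star_coloring V E 4 c"
    using b_star_coloring_4_exists[OF assms(1) _ _ u] assms(2) by (auto simp: numeral_eq_enat)
  moreover have "k \<le> 4" if "b_star_coloring V E k c" for k c
    using b_star_coloring_le[OF assms(1) that] assms(3) by simp
  ultimately show ?thesis unfolding b_star_def
    by (intro Max_eqI) (auto intro: finite_subset[of _ "{..4}"])
qed

end
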